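(* The following three identities hold: $$\sum_{n=0}^{\infty}\frac{(-1)^nq^{3n^2/2-n/2}}{(q^{n+1};q)_n}=2-\sum_{n=0}^{\infty}(-1)^nq^{-7n+15\binom{n+1}{2}}-q^7\sum_{n=0}^{\infty}(-1)^nq^{7n+15\binom{n+1}{2}}-q\sum_{n=0}^{\infty}(-1)^nq^{-2n+15\binom{n+1}{2}}-q^3\sum_{n=0}^{\infty}(-1)^nq^{2n+15\binom{n+1}{2}},$$ $$1+\sum_{n=0}^{\infty}\frac{(-1)^{n+1}q^{3n^2/2+n/2}}{(q^{n+1};q)_{n+1}}=1-\sum_{n=0}^{\infty}(-1)^nq^{-7n+15\binom{n+1}{2}}-q^7\sum_{n=0}^{\infty}(-1)^nq^{7n+15\binom{n+1}{2}}-q\sum_{n=0}^{\infty}(-1)^nq^{-2n+15\binom{n+1}{2}}-q^3\sum_{n=0}^{\infty}(-1)^nq^{2n+15\binom{n+1}{2}},$$ $$\sum_{n=0}^{\infty}\frac{(-1)^{n+1}q^{3\binom{n+1}{2}+1}}{(q^{n+1};q)_{n+1}}=-q\sum_{n=0}^{\infty}(-1)^nq^{-4n+15\binom{n+1}{2}}-q^5\sum_{n=0}^{\infty}(-1)^nq^{4n+15\binom{n+1}{2}}-q^2\sum_{n=0}^{\infty}(-1)^nq^{-n+15\binom{n+1}{2}}-q^3\sum_{n=0}^{\infty}(-1)^nq^{n+15\binom{n+1}{2}}.$$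
   Context: $q$ is a complex number with $0<|q|<1$, and $(x;q)_n=\prod_{i=0}^{n-1}(1-xq^i)$. *)

theory Defs
  imports "HOL-Analysis.Analysis"
begin

definition qpoch :: "complex \<Rightarrow> complex \<Rightarrow> nat \<Rightarrow> complex" where
  "qpoch x q n = (\<Prod>i<n. 1 - x * q ^ i)"

text \<open>
  The exponent is an integer because \<open>a\<close> may be negative; in the sums it is never negative.
\<close>

definition theta_term :: "complex \<Rightarrow> int \<Rightarrow> nat \<Rightarrow> complex" where
  "theta_term q a n = (-1) ^ n * q powi (a * int n + 15 * int ((n + 1) choose 2))"

text \<open>
  In the first two series the exponents \<open>3n\<^sup>2/2 - n/2\<close> and \<open>3n\<^sup>2/2 + n/2\<close> are integers,
  so the integer division is exact.
\<close>

definition lhs_term1 :: "complex \<Rightarrow> nat \<Rightarrow> complex" where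
  "lhs_term1 q n =
     (-1) ^ n * q powi ((3 * (int n)\<^sup>2 - int n) div 2) / qpoch (q ^ (n + 1)) q n"

definition lhs_term2 :: "complex \<Rightarrow> nat \<Rightarrow> complex" where
  "lhs_term2 q n =
     (-1) ^ (n + 1) * q powi ((3 * (int n)\<^sup>2 + int n) div 2) / qpoch (q ^ (n + 1)) q (n + 1)"

definition lhs_term3 :: "complex \<Rightarrow> nat \<Rightarrow> complex" where
  "lhs_term3 q n =
     (-1) ^ (n + 1) * q ^ (3 * ((n + 1) choose 2) + 1) / qpoch (q ^ (n + 1)) q (n + 1)"

end

theory Submission
  imports Defs
begin

text \<open>
  Write the \<open>n\<close>-th terms of the second and third series as
  \<open>(-1)\<^sup>n q\<^bsup>n(n+1)/2\<^esup> (q;q)\<^sub>n \<beta>\<^sub>n\<close>, up to sign and a factor \<open>q\<close>, with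
  \<open>\<beta>\<^sub>n = q\<^bsup>n\<^sup>2\<^esup>/(q;q)\<^bsub>2n+1\<^esub>\<close> and \<open>\<beta>\<^sub>n = q\<^bsup>n\<^sup>2+n\<^esup>/(q;q)\<^bsub>2n+1\<^esub>\<close>.
  These are the \<open>\<beta>\<close>-sides of Bailey pairs of Slater's group A relative to \<open>q\<close>:
  \<open>\<beta>\<^sub>n\<close> is a sum over integers \<open>k\<close> of a power of \<open>q\<close> times a difference of two terms
  \<open>1/((q;q)\<^bsub>n-r\<^esub> (q;q)\<^bsub>n+r+1\<^esub>)\<close>, with \<open>r\<close> affine in \<open>k\<close>. Both expansions follow
  from the two \<open>q\<close>-Pascal rules, up to terms telescoping in \<open>k\<close>. Interchanging the two
  summations leaves the sum over \<open>n\<close> of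
  \<open>(-1)\<^sup>n q\<^bsup>n(n+1)/2\<^esup> (q;q)\<^sub>n / ((q;q)\<^bsub>n-r\<^esub> (q;q)\<^bsub>n+r+1\<^esub>)\<close>, which is invariant under
  \<open>r \<mapsto> -1-r\<close> and which a WZ-style recurrence in \<open>r\<close> evaluates to
  \<open>(-1)\<^sup>r q\<^bsup>r(r+1)/2\<^esup>\<close> for \<open>r \<ge> 0\<close>. Splitting the bilateral sum at
  \<open>k = 0\<close> yields the four theta series. The first identity follows from the second because
  the difference of the two series telescopes.
\<close>

section \<open>Reciprocal q-factorials with integer index\<close>

text \<open>
  The value \<open>0\<close> at negative \<open>m\<close> makes the recurrence \<open>inv_qfact_rec\<close> hold for all integers, so
  the \<open>q\<close>-Pascal rules need no boundary conditions.
\<close>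

definition inv_qfact :: "complex \<Rightarrow> int \<Rightarrow> complex" where
  "inv_qfact q m = (if m < 0 then 0 else 1 / qpoch q q (nat m))"

lemma qpoch_0 [simp]: "qpoch x q 0 = 1"
  by (simp add: qpoch_def)

lemma qpoch_Suc: "qpoch x q (Suc n) = qpoch x q n * (1 - x * q ^ n)"
  by (simp add: qpoch_def)

lemma qpoch_add: "qpoch x q (m + n) = qpoch x q m * qpoch (x * q ^ m) q n"
  by (induction n) (simp_all add: qpoch_Suc power_add mult_ac)

lemma inv_qfact_of_nat: "inv_qfact q (int n) = 1 / qpoch q q n"
  by (simp add: inv_qfact_def)

lemma inv_qfact_neg: "m < 0 \<Longrightarrow> inv_qfact q m = 0"
  by (simp add: inv_qfact_def)

section \<open>Sums over the integers\<close>

text \<open>Finite support makes \<open>g\<close> summable, and the shift by 1 permutes the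
  integers, so both copies of \<open>g\<close> have the same sum and cancel.\<close>

lemma has_sum_int_telescope:
  fixes g :: "int \<Rightarrow> 'a :: {topological_ab_group_add, t2_space}"
  assumes "finite F" "\<And>k. k \<notin> F \<Longrightarrow> g k = 0"
  shows "((\<lambda>k. g (k + 1) - g k) has_sum 0) UNIV"
proof -
  have g: "(g has_sum sum g F) UNIV"
    by (rule has_sum_finite_neutralI[of F]) (use assms in auto)
  have "bij_betw (\<lambda>k::int. k + 1) UNIV UNIV"
    by (rule bij_betwI[of _ _ _ "\<lambda>k. k - 1"]) auto
  hence "((\<lambda>k. g (k + 1)) has_sum sum g F) UNIV"
    using has_sum_reindex_bij_betw[of "\<lambda>k::int. k + 1" UNIV UNIV g] g by blast
  moreover have "((\<lambda>k. - g k) has_sum - sum g F) UNIV"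
    using g by (simp add: has_sum_uminus)
  ultimately have "((\<lambda>k. g (k + 1) + - g k) has_sum (sum g F + - sum g F)) UNIV"
    by (rule has_sum_add)
  thus ?thesis by simp
qed

text \<open>Indexing the negative integers by \<open>- 1 - int n\<close> lets both halves run over
  all naturals and fits the reflection r -> -1-r of the kernel.\<close>

lemma has_sum_int_split:
  fixes f :: "int \<Rightarrow> 'a :: topological_comm_monoid_add"
  assumes "((\<lambda>n. f (int n)) has_sum a) UNIV" and "((\<lambda>n. f (- 1 - int n)) has_sum b) UNIV"
  shows "(f has_sum (a + b)) UNIV"
proof -
  have "UNIV = range int \<union> range (\<lambda>n. - 1 - int n)"
  proof (intro equalityI subsetI)
    fix k :: int
    show "k \<in> range int \<union> range (\<lambda>n. - 1 - int n)"
    proof (cases "k \<ge> 0")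
      case True
      hence "k = int (nat k)" by simp
      thus ?thesis by blast
    next
      case False
      hence "k = - 1 - int (nat (- 1 - k))" by simp
      thus ?thesis by blast
    qed
  qed auto
  moreover have "(f has_sum (a + b)) (range int \<union> range (\<lambda>n. - 1 - int n))"
    by (intro has_sum_Un_disjoint)
       (use assms in \<open>auto simp: has_sum_reindex inj_on_def o_def\<close>)
  ultimately show ?thesis by simp
qed

lemma summable_on_int_geometric:
  fixes c :: real
  assumes "0 \<le> c" "c < 1"
  shows "(\<lambda>k::int. c ^ nat \<bar>k\<bar>) summable_on UNIV"
proof -
  have 1: "(\<lambda>n. c ^ n) summable_on UNIV"
    by (rule summable_nonneg_imp_summable_on) (use assms in \<open>simp_all add: summable_geometric\<close>)
  have "(\<lambda>n. c * c ^ n) summable_on UNIV"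
    by (rule summable_on_cmult_right[OF 1])
  hence 2: "(\<lambda>n. c ^ nat \<bar>- 1 - int n\<bar>) summable_on UNIV"
    by (simp add: nat_add_distrib abs_if)
  show ?thesis
    using has_sum_int_split[of "\<lambda>k. c ^ nat \<bar>k\<bar>"] 1 2
    by (auto simp: summable_on_def)
qed

text \<open>Supplies the majorant for interchanging the sums over \<open>n\<close> and
  \<open>k\<close>.\<close>

lemma summable_on_geometric_product:
  fixes c :: real
  assumes "0 \<le> c" "c < 1"
  shows "(\<lambda>(n, k). c ^ n * c ^ nat \<bar>k\<bar>) summable_on (UNIV :: (nat \<times> int) set)"
proof -
  have 1: "(\<lambda>n. c ^ n) summable_on UNIV"
    by (rule summable_nonneg_imp_summable_on) (use assms in \<open>simp_all add: summable_geometric\<close>)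
  have "Infinite_Set_Sum.abs_summable_on (\<lambda>(n, k). c ^ n * c ^ nat \<bar>k\<bar>) ((UNIV :: nat set) \<times> (UNIV :: int set))"
    by (rule abs_summable_on_product)
       (use 1 summable_on_int_geometric[OF assms] assms in \<open>simp_all flip: abs_summable_equivalent\<close>)
  hence "(\<lambda>x. norm (case x of (n, k) \<Rightarrow> c ^ n * c ^ nat \<bar>k\<bar>)) summable_on ((UNIV :: nat set) \<times> (UNIV :: int set))"
    unfolding abs_summable_equivalent[symmetric] .
  from abs_summable_summable[OF this] show ?thesis by simp
qed

section \<open>Non-vanishing and the q-Pascal rules\<close>

locale q_series =
  fixes q :: complex
  assumes q_pos: "0 < norm q" and q_lt: "norm q < 1"
begin

lemma q_nz: "q \<noteq> 0"
  using q_pos by auto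

lemma one_minus_q_power_nz: "0 < n \<Longrightarrow> 1 - q ^ n \<noteq> 0"
proof
  assume "0 < n" "1 - q ^ n = 0"
  hence "norm q ^ n = 1" by (simp flip: norm_power)
  moreover have "norm q ^ n < 1" using q_lt \<open>0 < n\<close> by (simp add: power_less_one_iff)
  ultimately show False by simp
qed

lemma qpoch_power_nz: "0 < m \<Longrightarrow> qpoch (q ^ m) q n \<noteq> 0"
  using one_minus_q_power_nz by (auto simp: qpoch_def simp flip: power_add)

lemma qpoch_self_nz: "qpoch q q n \<noteq> 0"
  using qpoch_power_nz[of 1] by simp

text \<open>At m = 0 the factor \<open>1 - q powi m\<close> vanishes, in agreement with the value 0
  at -1; for m < 0 both sides are 0.\<close>

lemma inv_qfact_rec: "inv_qfact q (m - 1) = (1 - q powi m) * inv_qfact q m"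
proof (cases "m > 0")
  case True
  define n where "n = nat (m - 1)"
  have m: "m = int (Suc n)" using True by (simp add: n_def)
  have "inv_qfact q (int n) = (1 - q ^ Suc n) * inv_qfact q (int (Suc n))"
    using qpoch_self_nz one_minus_q_power_nz[of "Suc n"]
    by (simp only: inv_qfact_of_nat qpoch_Suc) (simp add: field_simps)
  thus ?thesis by (simp only: m power_int_of_nat) simp
qed (auto simp: inv_qfact_def)

text \<open>Split 1 - q^(a+b) as (1 - q^a) + q^a (1 - q^b); each bracket lowers one index.
  Exchanging a and b in the split gives the mirrored rule \<open>q_pascal'\<close>.\<close>

lemma q_pascal:
  "(1 - q powi (a + b)) * (inv_qfact q a * inv_qfact q b) =
     inv_qfact q (a - 1) * inv_qfact q b + q powi a * (inv_qfact q a * inv_qfact q (b - 1))"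
  using q_nz by (simp add: inv_qfact_rec power_int_add algebra_simps)

lemma q_pascal':
  "(1 - q powi (a + b)) * (inv_qfact q a * inv_qfact q b) =
     inv_qfact q a * inv_qfact q (b - 1) + q powi b * (inv_qfact q (a - 1) * inv_qfact q b)"
  using q_nz by (simp add: inv_qfact_rec power_int_add algebra_simps)

lemma q_powi_mult: "q powi a * (q powi b * z) = q powi (a + b) * z"
  using q_nz by (simp add: power_int_add)

section \<open>Expansions of the Bailey pairs\<close>

text \<open>In each product the two indices add up to 2n, so multiplication by (q;q)_(2n) yields
  q-binomial coefficients of row 2n. The two odd variants belong to row 2n+1.\<close>

definition even_row_term :: "int \<Rightarrow> int \<Rightarrow> complex" where
  "even_row_term n k = q powi (3 * k\<^sup>2 - k) *
     (inv_qfact q (n - 3 * k) * inv_qfact q (n + 3 * k)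
      - inv_qfact q (n - 3 * k + 1) * inv_qfact q (n + 3 * k - 1))"

definition odd_row_term :: "int \<Rightarrow> int \<Rightarrow> complex" where
  "odd_row_term n k = q powi (3 * k\<^sup>2 - k) *
     (inv_qfact q (n - 3 * k) * inv_qfact q (n + 3 * k + 1)
      - inv_qfact q (n - 3 * k + 2) * inv_qfact q (n + 3 * k - 1))"

definition odd_row_shifted_term :: "int \<Rightarrow> int \<Rightarrow> complex" where
  "odd_row_shifted_term n k = q powi (3 * k\<^sup>2 + 2 * k) *
     (inv_qfact q (n - 3 * k) * inv_qfact q (n + 3 * k + 1)
      - inv_qfact q (n - 3 * k - 1) * inv_qfact q (n + 3 * k + 2))"

lemma mult_diff_rearrange:
  fixes c :: "'a :: comm_ring"
  assumes "c * x = x'" "c * y = y'"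
  shows "c * (w * (x - y)) = w * (x' - y')"
  using assms by (auto simp: algebra_simps)

text \<open>The two products are expanded by opposite Pascal rules, so that their unweighted parts
  coincide and cancel. Of the weighted parts, one is the first half of the even-row term and the
  other is \<open>g n (k + 1)\<close>; subtracting \<open>g n k\<close> supplies the missing second
  half.\<close>

lemma odd_row_shifted_term_rec:
  defines "g \<equiv> \<lambda>n k. - (q powi (n + 3 * k\<^sup>2 - k)) * (inv_qfact q (n - 3 * k + 1) * inv_qfact q (n + 3 * k - 1))"
  shows "(1 - q powi (2 * n + 1)) * odd_row_shifted_term n k = q powi n * even_row_term n k + (g n (k + 1) - g n k)"
proof -
  have e: "n - 3 * k + (n + 3 * k + 1) = 2 * n + 1" "n - 3 * k - 1 + (n + 3 * k + 2) = 2 * n + 1"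
    by simp_all
  show ?thesis
    unfolding odd_row_shifted_term_def
    by (subst mult_diff_rearrange[OF q_pascal[of "n - 3 * k" "n + 3 * k + 1", unfolded e]
          q_pascal'[of "n - 3 * k - 1" "n + 3 * k + 2", unfolded e]])
       (simp add: even_row_term_def g_def q_powi_mult distrib_left right_diff_distrib mult.assoc,
        simp add: algebra_simps power2_eq_square)
qed

text \<open>With the Pascal rules exchanged, the unweighted parts form the even-row term and the
  weighted parts telescope.\<close>

lemma odd_row_term_rec:
  defines "g \<equiv> \<lambda>n k. q powi (n + 3 * k\<^sup>2 - 4 * k + 2) * (inv_qfact q (n - 3 * k + 2) * inv_qfact q (n + 3 * k - 2))"
  shows "(1 - q powi (2 * n + 1)) * odd_row_term n k = even_row_term n k + (g n (k + 1) - g n k)"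
proof -
  have e: "n - 3 * k + (n + 3 * k + 1) = 2 * n + 1" "n - 3 * k + 2 + (n + 3 * k - 1) = 2 * n + 1"
    by simp_all
  show ?thesis
    unfolding odd_row_term_def
    by (subst mult_diff_rearrange[OF q_pascal'[of "n - 3 * k" "n + 3 * k + 1", unfolded e]
          q_pascal[of "n - 3 * k + 2" "n + 3 * k - 1", unfolded e]])
       (simp add: even_row_term_def g_def q_powi_mult distrib_left right_diff_distrib mult.assoc,
        simp add: algebra_simps power2_eq_square)
qed

text \<open>The unweighted parts cancel again. The first weighted part is the first half of the
  shifted term of row 2n-1, and \<open>g n (k + 1)\<close> cancels its second half.\<close>

lemma even_row_term_rec:
  defines "g \<equiv> \<lambda>n k. q powi (n + 3 * k\<^sup>2 - 4 * k + 1) * (inv_qfact q (n - 3 * k + 1) * inv_qfact q (n + 3 * k - 2))"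
  shows "(1 - q powi (2 * n)) * even_row_term n k = q powi n * odd_row_shifted_term (n - 1) k + (g n (k + 1) - g n k)"
proof -
  have e: "n - 3 * k + (n + 3 * k) = 2 * n" "n - 3 * k + 1 + (n + 3 * k - 1) = 2 * n"
    by simp_all
  show ?thesis
    unfolding even_row_term_def
    by (subst mult_diff_rearrange[OF q_pascal'[of "n - 3 * k" "n + 3 * k", unfolded e]
          q_pascal[of "n - 3 * k + 1" "n + 3 * k - 1", unfolded e]])
       (simp add: odd_row_shifted_term_def g_def q_powi_mult distrib_left right_diff_distrib mult.assoc,
        simp add: algebra_simps power2_eq_square)
qed

text \<open>Summing \<open>rec\<close> over \<open>k\<close> removes the \<open>g\<close>-part, and
  \<open>1 - q powi m\<close> can be divided out. The window fits every \<open>g\<close> applied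
  here: for |k| > |n| + 2 one of its two indices is negative.\<close>

lemma has_sum_of_telescoping_rec:
  fixes m n :: int and \<alpha> \<beta> :: complex and g :: "int \<Rightarrow> complex"
  assumes m: "m > 0"
      and f: "(f has_sum s) UNIV"
      and rec: "\<And>k. (1 - q powi m) * h k = c * f k + (g (k + 1) - g k)"
      and g: "\<And>k. k \<notin> {-\<bar>n\<bar> - 2..\<bar>n\<bar> + 2} \<Longrightarrow> g k = 0"
      and t: "c * s = (1 - q powi m) * t"
  shows "(h has_sum t) UNIV"
proof -
  have nz: "1 - q powi m \<noteq> 0"
    using one_minus_q_power_nz[of "nat m"] m by (simp add: power_int_def)
  have "((\<lambda>k. c * f k + (g (k + 1) - g k)) has_sum (c * s + 0)) UNIV"
    by (intro has_sum_add has_sum_cmult_right f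
          has_sum_int_telescope[of "{-\<bar>n\<bar> - 2..\<bar>n\<bar> + 2}"] g) simp_all
  hence "((\<lambda>k. (1 - q powi m) * h k) has_sum (1 - q powi m) * t) UNIV"
    by (simp add: rec t)
  thus ?thesis using nz by (simp add: has_sum_cmult_right_iff)
qed

lemma inv_qfact_rec': "inv_qfact q m = (1 - q powi (m + 1)) * inv_qfact q (m + 1)"
  using inv_qfact_rec[of "m + 1"] by simp

lemma odd_row_shifted_term_has_sum_step:
  assumes "(even_row_term (int n) has_sum q ^ (n\<^sup>2) * inv_qfact q (2 * int n)) UNIV"
  shows "(odd_row_shifted_term (int n) has_sum q ^ (n\<^sup>2 + n) * inv_qfact q (2 * int n + 1)) UNIV"
  by (rule has_sum_of_telescoping_rec[OF _ assms odd_row_shifted_term_rec, where n = "int n"])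
     (auto simp: inv_qfact_neg inv_qfact_rec'[of "2 * int n"] power_add)

text \<open>The induction climbs from row 2n through the shifted row 2n+1 to row 2n+2; the exponents
  add up as n^2 + n + (n+1) = (n+1)^2.\<close>

lemma even_row_term_has_sum:
  "(even_row_term (int n) has_sum q ^ (n\<^sup>2) * inv_qfact q (2 * int n)) UNIV"
proof (induction n)
  case 0
  have "even_row_term 0 k = 0" if "k \<notin> {0}" for k :: int
    using that by (cases "k > 0") (simp_all add: even_row_term_def inv_qfact_neg)
  hence "(even_row_term 0 has_sum (\<Sum>k\<in>{0}. even_row_term 0 k)) UNIV"
    by (intro has_sum_finite_neutralI[of "{0}"]) auto
  moreover have "even_row_term 0 0 = 1"
    by (simp add: even_row_term_def inv_qfact_def)
  moreover have "inv_qfact q 0 = 1"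
    by (simp add: inv_qfact_def)
  ultimately show ?case by simp
next
  case (Suc n)
  have rec: "(1 - q powi (2 * int n + 2)) * inv_qfact q (2 * int n + 2) = inv_qfact q (2 * int n + 1)"
    by (subst inv_qfact_rec [symmetric]) (simp add: add.commute)
  have b: "(odd_row_shifted_term (int (Suc n) - 1) has_sum q ^ (n\<^sup>2 + n) * inv_qfact q (2 * int n + 1)) UNIV"
    using odd_row_shifted_term_has_sum_step[OF Suc.IH] by simp
  have "q powi int (Suc n) * (q ^ (n\<^sup>2 + n) * inv_qfact q (2 * int n + 1)) =
        (1 - q powi (2 * int (Suc n))) * (q ^ ((Suc n)\<^sup>2) * inv_qfact q (2 * int (Suc n)))"
    by (simp only: power_int_of_nat flip: rec)
       (simp add: power_add power2_eq_square algebra_simps)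
  thus ?case
    by (intro has_sum_of_telescoping_rec[OF _ b even_row_term_rec, where n = "int (Suc n)"])
       (auto simp: inv_qfact_neg)
qed

lemmas odd_row_shifted_term_has_sum = odd_row_shifted_term_has_sum_step[OF even_row_term_has_sum]

lemma odd_row_term_has_sum:
  "(odd_row_term (int n) has_sum q ^ (n\<^sup>2) * inv_qfact q (2 * int n + 1)) UNIV"
proof -
  \<comment> \<open>The explicit factor 1 makes the recurrence match the pattern
    \<open>c * f k\<close>.\<close>
  have rec: "(1 - q powi (2 * n + 1)) * odd_row_term n k = 1 * even_row_term n k +
    (q powi (n + 3 * (k+1)\<^sup>2 - 4 * (k+1) + 2) * (inv_qfact q (n - 3 * (k+1) + 2) * inv_qfact q (n + 3 * (k+1) - 2)) -
     q powi (n + 3 * k\<^sup>2 - 4 * k + 2) * (inv_qfact q (n - 3 * k + 2) * inv_qfact q (n + 3 * k - 2)))"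
    for n k :: int
    using odd_row_term_rec[of n k] by simp
  show ?thesis
    by (rule has_sum_of_telescoping_rec[OF _ even_row_term_has_sum rec, where n = "int n"])
       (auto simp: inv_qfact_neg inv_qfact_rec'[of "2 * int n"])
qed

section \<open>The kernel: telescoping, bounds and evaluation\<close>

text \<open>These are the weights of Bailey's lemma relative to q when one parameter equals q and
  the other tends to infinity.\<close>

definition bailey_weight :: "nat \<Rightarrow> complex" where
  "bailey_weight n = (-1) ^ n * q ^ ((n + 1) choose 2) * qpoch q q n"

definition inv_qfact_pair :: "nat \<Rightarrow> int \<Rightarrow> complex" where
  "inv_qfact_pair n r = inv_qfact q (int n - r) * inv_qfact q (int n + r + 1)"

lemma inv_qfact_pair_reflect: "inv_qfact_pair n (- 1 - r) = inv_qfact_pair n r"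
  by (simp add: inv_qfact_pair_def algebra_simps)

lemma Suc_choose_2: "(Suc n + 1) choose 2 = ((n + 1) choose 2) + Suc n"
  by (simp add: numeral_2_eq_2)

lemma bailey_weight_Suc: "bailey_weight (Suc n) = - bailey_weight n * (q ^ Suc n * (1 - q ^ Suc n))"
  by (simp only: bailey_weight_def Suc_choose_2 qpoch_Suc) (simp add: power_add mult_ac)

lemma kernel_algebra:
  fixes u v w y g a b :: complex
  assumes "u + y * v = (1 + y) * (u * v + w)"
  shows "g * (u * a * b) + y * (g * (a * (v * b))) =
         (1 + y) * g * (u * a * (v * b)) - (1 + y) * (- g * w) * (a * b)"
proof -
  have "g * (u * a * b) + y * (g * (a * (v * b))) = g * a * b * (u + y * v)"
    by (simp add: algebra_simps)
  also have "\<dots> = (1 + y) * g * (u * a * (v * b)) - (1 + y) * (- g * w) * (a * b)"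
    unfolding assms by (simp add: algebra_simps)
  finally show ?thesis .
qed

text \<open>\<open>R\<close> is the WZ certificate. All reciprocal q-factorials involved are
  multiples of \<open>a\<close> and \<open>b\<close>, which leaves a rational identity in x = q^n
  and y = q^r.\<close>

lemma kernel_telescope:
  defines "R \<equiv> \<lambda>n r. (1 + q powi (r + 1)) * bailey_weight n * (inv_qfact q (int n - r - 1) * inv_qfact q (int n + r + 1))"
  shows "bailey_weight n * inv_qfact_pair n (r + 1) + q powi (r + 1) * (bailey_weight n * inv_qfact_pair n r)
           = R n r - R (Suc n) r"
proof -
  define x y where "x = q ^ n" and "y = q powi r"
  define a b where "a = inv_qfact q (int n - r)" and "b = inv_qfact q (int n + r + 2)"
  have y: "y \<noteq> 0" using q_nz by (simp add: y_def)
  have 1: "inv_qfact q (int n - r - 1) = (1 - x / y) * a"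
    using inv_qfact_rec[of "int n - r"] q_nz by (simp add: a_def x_def y_def power_int_diff)
  have 2: "inv_qfact q (int n + r + 1) = (1 - x * y * q\<^sup>2) * b"
    using inv_qfact_rec'[of "int n + r + 1"] q_nz
    by (simp add: b_def x_def y_def power_int_add power2_eq_square mult_ac add_ac)
  have 3: "inv_qfact_pair n (r + 1) = (1 - x / y) * a * b"
  proof -
    have "int n - (r + 1) = int n - r - 1" "int n + (r + 1) + 1 = int n + r + 2" by simp_all
    thus ?thesis by (simp only: inv_qfact_pair_def b_def 1)
  qed
  have 4: "inv_qfact_pair n r = a * ((1 - x * y * q\<^sup>2) * b)"
    using 2 by (simp add: inv_qfact_pair_def a_def)
  have 5: "q powi (r + 1) = y * q" using q_nz by (simp add: y_def power_int_add)
  have 6: "int (Suc n) - r - 1 = int n - r" "int (Suc n) + r + 1 = int n + r + 2" by simp_all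
  have 7: "bailey_weight (Suc n) = - bailey_weight n * (q * x * (1 - q * x))"
    by (simp add: bailey_weight_Suc x_def)
  have "(1 - x / y) + y * q * (1 - x * y * q\<^sup>2) =
        (1 + y * q) * ((1 - x / y) * (1 - x * y * q\<^sup>2) + q * x * (1 - q * x))"
    using y by (simp add: field_simps power2_eq_square)
  from kernel_algebra[OF this, of "bailey_weight n" a b] show ?thesis
    unfolding R_def 6 7 1 2 3 4 5 a_def[symmetric] b_def[symmetric] .
qed

text \<open>(q;q)_n converges to a non-zero infinite product, so both the sequence and its
  reciprocals are bounded.\<close>

lemma qpoch_self_bounds:
  obtains D where "D > 0" "\<And>n. norm (qpoch q q n) \<le> D" "\<And>m. norm (inv_qfact q m) \<le> D"
proof -
  define f where "f i = 1 - q * q ^ i" for i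
  have f_nz: "f i \<noteq> 0" for i
    using one_minus_q_power_nz[of "Suc i"] by (simp add: f_def)
  have "summable (\<lambda>i. norm (f i - 1))"
    using q_lt by (simp add: f_def norm_mult norm_power summable_mult summable_geometric)
  hence conv: "convergent_prod f"
    by (intro abs_convergent_prod_imp_convergent_prod summable_imp_abs_convergent_prod)
  hence lim: "(\<lambda>n. prod f {..n}) \<longlonglongrightarrow> prodinf f" and nz: "prodinf f \<noteq> 0"
    using prodinf_nonzero[OF conv f_nz] convergent_prod_LIMSEQ by blast+
  have qp: "(\<lambda>n. qpoch q q (Suc n)) = (\<lambda>n. prod f {..n})"
    by (simp add: qpoch_def f_def fun_eq_iff lessThan_Suc_atMost)
  have lim1: "(\<lambda>n. qpoch q q n) \<longlonglongrightarrow> prodinf f"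
    by (rule LIMSEQ_imp_Suc) (use lim qp in simp)
  have lim2: "(\<lambda>n. 1 / qpoch q q n) \<longlonglongrightarrow> 1 / prodinf f"
    by (intro tendsto_intros lim1 nz)
  obtain D1 where D1: "\<And>n. norm (qpoch q q n) \<le> D1"
    using convergentI[OF lim1, THEN convergent_imp_Bseq] by (auto simp: Bseq_def)
  obtain D2 where D2: "\<And>n. norm (1 / qpoch q q n) \<le> D2" "D2 > 0"
    using convergentI[OF lim2, THEN convergent_imp_Bseq] by (rule BseqE) blast
  have "norm (inv_qfact q m) \<le> D2" for m
    using D2(1)[of "nat m"] D2(2) by (auto simp: inv_qfact_def)
  thus ?thesis
    using that[of "max D1 D2"] D1 D2(2) by (simp add: le_max_iff_disj less_max_iff_disj)
qed

text \<open>The decay comes from q^(n(n+1)/2), as n(n+1)/2 >= n; the other three factors are bounded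
  by \<open>D\<close>. Uniformity in \<open>a\<close> and \<open>b\<close> serves the vanishing of
  boundary terms, the summability over \<open>n\<close> and the interchange of sums.\<close>

lemma kernel_bound:
  obtains C where "C > 0"
    "\<And>n a b. norm (bailey_weight n * (inv_qfact q a * inv_qfact q b)) \<le> C * norm q ^ n"
proof -
  obtain D where D: "D > 0" "\<And>n. norm (qpoch q q n) \<le> D" "\<And>m. norm (inv_qfact q m) \<le> D"
    using qpoch_self_bounds by blast
  have "norm (bailey_weight n * (inv_qfact q a * inv_qfact q b)) \<le> D ^ 3 * norm q ^ n" for n a b
  proof -
    have "n \<le> (n + 1) choose 2"
      by (induction n) (auto simp: numeral_2_eq_2)
    hence "norm q ^ ((n + 1) choose 2) \<le> norm q ^ n"
      using q_lt by (intro power_decreasing) auto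
    hence "norm q ^ ((n + 1) choose 2) * norm (qpoch q q n) *
             (norm (inv_qfact q a) * norm (inv_qfact q b)) \<le> norm q ^ n * D * (D * D)"
      using D by (intro mult_mono) auto
    thus ?thesis
      by (simp add: bailey_weight_def norm_mult norm_power power3_eq_cube mult_ac)
  qed
  thus ?thesis using that[of "D ^ 3"] D(1) by simp
qed

lemma kernel_tendsto_0:
  "(\<lambda>n. bailey_weight n * (inv_qfact q (a n) * inv_qfact q (b n))) \<longlonglongrightarrow> 0"
proof -
  obtain C where "C > 0"
    and C: "\<And>n a b. norm (bailey_weight n * (inv_qfact q a * inv_qfact q b)) \<le> C * norm q ^ n"
    by (rule kernel_bound) blast
  have "(\<lambda>n. C * norm q ^ n) \<longlonglongrightarrow> 0"
    by (rule tendsto_mult_right_zero, rule LIMSEQ_realpow_zero) (use q_lt in auto)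
  thus ?thesis
    by (rule Lim_null_comparison[rotated]) (simp_all add: C)
qed

lemma kernel_summable_norm: "summable (\<lambda>n. norm (bailey_weight n * inv_qfact_pair n r))"
proof -
  obtain C where "C > 0"
    and C: "\<And>n a b. norm (bailey_weight n * (inv_qfact q a * inv_qfact q b)) \<le> C * norm q ^ n"
    by (rule kernel_bound) blast
  show ?thesis
    by (rule summable_comparison_test'[of "\<lambda>n. C * norm q ^ n" 0])
       (use q_lt in \<open>simp_all add: C inv_qfact_pair_def summable_mult summable_geometric\<close>)
qed

definition kernel_sum :: "int \<Rightarrow> complex" where
  "kernel_sum r = (\<Sum>n. bailey_weight n * inv_qfact_pair n r)"

lemma kernel_sums: "(\<lambda>n. bailey_weight n * inv_qfact_pair n r) sums kernel_sum r"
  unfolding kernel_sum_def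
  by (rule summable_sums[OF summable_norm_cancel[OF kernel_summable_norm]])

lemma kernel_sum_reflect: "kernel_sum (- 1 - r) = kernel_sum r"
  unfolding kernel_sum_def inv_qfact_pair_reflect ..

text \<open>Since \<open>R n\<close> tends to 0, summing \<open>kernel_telescope\<close> over
  \<open>n\<close> leaves \<open>R 0\<close>. This is non-zero only at r = -1, where neither index
  is negative.\<close>

lemma kernel_sum_rec:
  "kernel_sum (r + 1) + q powi (r + 1) * kernel_sum r =
     (1 + q powi (r + 1)) * (inv_qfact q (- r - 1) * inv_qfact q (r + 1))"
proof -
  define R where "R n = (1 + q powi (r + 1)) * bailey_weight n *
    (inv_qfact q (int n - r - 1) * inv_qfact q (int n + r + 1))" for n
  have "(\<lambda>n. (1 + q powi (r + 1)) * (bailey_weight n *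
           (inv_qfact q (int n - r - 1) * inv_qfact q (int n + r + 1)))) \<longlonglongrightarrow> 
           (1 + q powi (r + 1)) * 0"
    by (rule tendsto_mult[OF tendsto_const kernel_tendsto_0])
  hence "R \<longlonglongrightarrow> 0" by (simp add: R_def[abs_def] mult.assoc)
  from telescope_sums'[OF this]
  have "(\<lambda>n. bailey_weight n * inv_qfact_pair n (r + 1) +
           q powi (r + 1) * (bailey_weight n * inv_qfact_pair n r)) sums R 0"
    by (simp only: kernel_telescope R_def) simp
  moreover have "(\<lambda>n. bailey_weight n * inv_qfact_pair n (r + 1) +
           q powi (r + 1) * (bailey_weight n * inv_qfact_pair n r)) sums 
           (kernel_sum (r + 1) + q powi (r + 1) * kernel_sum r)"
    by (intro sums_add sums_mult kernel_sums)
  ultimately have "kernel_sum (r + 1) + q powi (r + 1) * kernel_sum r = R 0"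
    by (rule sums_unique2[symmetric])
  thus ?thesis by (simp add: R_def bailey_weight_def binomial_eq_0)
qed

lemma kernel_sum_of_nat: "kernel_sum (int r) = (-1) ^ r * q ^ ((r + 1) choose 2)"
proof (induction r)
  case 0
  \<comment> \<open>At r = -1 the recurrence relates the values at 0 and -1, which the reflection
    identifies.\<close>
  have "kernel_sum 0 + kernel_sum 0 = 1 + 1"
    using kernel_sum_rec[of "-1"] kernel_sum_reflect[of 0] by (simp add: inv_qfact_def)
  thus ?case by (simp add: binomial_eq_0)
next
  case (Suc r)
  have "kernel_sum (int (Suc r)) = - (q ^ Suc r) * kernel_sum (int r)"
    using kernel_sum_rec[of "int r"] 
    by (simp add: inv_qfact_neg power_int_add q_nz add.commute[of 1] mult.commute[of q] eq_neg_iff_add_eq_0)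
  thus ?case by (simp only: Suc.IH Suc_choose_2) (simp add: power_add mult_ac)
qed

section \<open>Interchange of the two summations\<close>

text \<open>The double series \<open>F\<close> is dominated by a product of geometric series.
  Summing over \<open>k\<close> first gives \<open>bailey_weight n * b n\<close>, summing over
  \<open>n\<close> first gives the kernel sums, and both iterated sums equal
  \<open>S\<close>.\<close>

lemma weighted_kernel_interchange:
  fixes w :: "int \<Rightarrow> complex" and \<rho> \<sigma> :: "int \<Rightarrow> int"
  assumes w: "\<And>k. norm (w k) \<le> norm q ^ nat \<bar>k\<bar>"
  assumes b: "\<And>n. ((\<lambda>k. w k * (inv_qfact_pair n (\<rho> k) - inv_qfact_pair n (\<sigma> k))) has_sum b n) UNIV"
  assumes s: "((\<lambda>k. w k * (kernel_sum (\<rho> k) - kernel_sum (\<sigma> k))) has_sum s) UNIV"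
  shows "(\<lambda>n. bailey_weight n * b n) sums s"
proof -
  define F where "F n k = w k * (bailey_weight n * inv_qfact_pair n (\<rho> k)
    - bailey_weight n * inv_qfact_pair n (\<sigma> k))" for n k
  obtain C where "C > 0"
    and C: "\<And>n a b. norm (bailey_weight n * (inv_qfact q a * inv_qfact q b)) \<le> C * norm q ^ n"
    by (rule kernel_bound) blast
  have F_bound: "norm (F n k) \<le> 2 * C * (norm q ^ n * norm q ^ nat \<bar>k\<bar>)" for n k
  proof -
    have "norm (F n k) \<le> norm q ^ nat \<bar>k\<bar> * (C * norm q ^ n + C * norm q ^ n)"
      unfolding F_def norm_mult[of "w k"] inv_qfact_pair_def
      by (intro mult_mono w order.trans[OF norm_triangle_ineq4] add_mono C) simp_all
    thus ?thesis by (simp add: mult_ac)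
  qed
  have "(\<lambda>p. 2 * C * (case p of (n, k) \<Rightarrow> norm q ^ n * norm q ^ nat \<bar>k\<bar>)) summable_on UNIV"
    by (intro summable_on_cmult_right summable_on_geometric_product) (use q_lt in auto)
  hence "(\<lambda>p. norm (case p of (n, k) \<Rightarrow> F n k)) summable_on UNIV"
    by (rule summable_on_comparison_test) (use F_bound in auto)
  hence "(\<lambda>(n, k). F n k) summable_on UNIV"
    by (rule abs_summable_summable)
  then obtain S where S: "((\<lambda>(n, k). F n k) has_sum S) (UNIV \<times> UNIV)"
    by (auto simp: summable_on_def)
  have "((\<lambda>k. F n k) has_sum bailey_weight n * b n) UNIV" for n
    using has_sum_cmult_right[OF b, of "bailey_weight n" n]
    by (simp add: F_def algebra_simps)
  with S have 1: "((\<lambda>n. bailey_weight n * b n) has_sum S) UNIV"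
    by (intro has_sum_SigmaD[OF S]) simp
  have kernel: "((\<lambda>n. bailey_weight n * inv_qfact_pair n r) has_sum kernel_sum r) UNIV" for r
    by (rule norm_summable_imp_has_sum[OF kernel_summable_norm kernel_sums])
  have "((\<lambda>n. F n k) has_sum w k * (kernel_sum (\<rho> k) - kernel_sum (\<sigma> k))) UNIV" for k
    using has_sum_cmult_right[OF has_sum_add[OF kernel has_sum_uminusI[OF kernel]], of "w k" "\<rho> k" "\<sigma> k"]
    by (simp add: F_def)
  hence "((\<lambda>k. w k * (kernel_sum (\<rho> k) - kernel_sum (\<sigma> k))) has_sum S) UNIV"
    using S by (intro has_sum_SigmaD[OF iffD1[OF has_sum_swap S]]) simp
  with s have "S = s" by (rule has_sum_unique[symmetric])
  with 1 show ?thesis by (simp add: has_sum_imp_sums)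
qed

section \<open>Theta series from bilateral kernel sums\<close>

lemma triangular_double: "2 * int ((n + 1) choose 2) = int n * (int n + 1)"
  by (induction n) (simp_all add: numeral_2_eq_2 algebra_simps)

text \<open>As n^2 >= n, the exponent is at least -7n + 15n, hence at least n.\<close>

lemma theta_term_bound:
  assumes "\<bar>a\<bar> \<le> 7"
  shows "norm (theta_term q a n) \<le> norm q ^ n"
proof -
  have "a * int n \<ge> -7 * int n"
    using assms by (intro mult_right_mono) auto
  moreover have "int n * int n \<ge> int n"
    by (cases n) simp_all
  ultimately have *: "a * int n + 15 * int ((n + 1) choose 2) \<ge> int n"
    using triangular_double[of n] by (simp add: algebra_simps)
  hence "norm q powi (a * int n + 15 * int ((n + 1) choose 2)) \<le> norm q powi int n"
    by (intro power_int_decreasing) (use q_pos q_lt in auto)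
  thus ?thesis
    by (simp add: theta_term_def norm_mult norm_power norm_power_int)
qed

lemma theta_term_summable_norm:
  assumes "\<bar>a\<bar> \<le> 7"
  shows "summable (\<lambda>n. norm (theta_term q a n))"
  by (rule summable_comparison_test'[of "\<lambda>n. norm q ^ n" 0])
     (use theta_term_bound[OF assms] q_lt in \<open>simp_all add: summable_geometric\<close>)

lemma theta_term_has_sum:
  assumes "\<bar>a\<bar> \<le> 7"
  shows "(theta_term q a has_sum (\<Sum>n. theta_term q a n)) UNIV"
  using theta_term_summable_norm[OF assms]
  by (intro norm_summable_imp_has_sum summable_sums[OF summable_norm_cancel])

text \<open>Describing the triangular numbers \<open>c\<close> and \<open>d\<close> by their doubles
  turns the exponent condition into polynomial arithmetic without binomials or division.\<close>

lemma weighted_kernel_sum_eq_theta_term: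
  assumes "\<And>c d. 2 * c = int r * (int r + 1) \<Longrightarrow> 2 * d = int n * (int n + 1) \<Longrightarrow>
             e + c = int m + (a * int n + 15 * d)"
  shows "q powi e * kernel_sum (int r) = (-1) ^ (r + n) * (q ^ m * theta_term q a n)"
proof -
  have "q powi e * kernel_sum (int r) = (-1) ^ r * (q powi e * q powi int ((r + 1) choose 2))"
    by (simp add: kernel_sum_of_nat)
  also have "q powi e * q powi int ((r + 1) choose 2) = q powi (e + int ((r + 1) choose 2))"
    using q_nz by (simp add: power_int_add)
  also have "e + int ((r + 1) choose 2) = int m + (a * int n + 15 * int ((n + 1) choose 2))"
    by (rule assms[OF triangular_double triangular_double])
  also have "q powi \<dots> = q ^ m * q powi (a * int n + 15 * int ((n + 1) choose 2))"
    using q_nz power_int_add[of q "int m"] by simp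
  also have "(-1) ^ r * \<dots> = (-1) ^ (r + n) * (q ^ m * theta_term q a n)"
    by (simp add: theta_term_def power_add)
  finally show ?thesis .
qed

lemma powi_norm_le:
  assumes "int m \<le> e"
  shows "norm (q powi e) \<le> norm q ^ m"
  using power_int_decreasing[OF assms, of "norm q"] q_pos q_lt by (simp add: norm_power_int)

text \<open>\<open>r1\<close> and \<open>r2\<close> give the non-negative representative of
  \<open>\<rho> k\<close> under r -> -1-r on the halves k >= 0 and k < 0; each half becomes one
  theta series.\<close>

lemma has_sum_weighted_kernel:
  fixes e :: "int \<Rightarrow> int" and \<rho> :: "int \<Rightarrow> int" and r1 r2 :: "nat \<Rightarrow> nat"
  assumes bound: "\<bar>a\<bar> \<le> 7" "\<bar>b\<bar> \<le> 7"
  assumes pos: "\<And>n. \<rho> (int n) \<in> {int (r1 n), - 1 - int (r1 n)}"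
    and neg: "\<And>n. \<rho> (- 1 - int n) \<in> {int (r2 n), - 1 - int (r2 n)}"
  assumes sgn: "\<And>n. (-1) ^ (r1 n + n) = s" "\<And>n. (-1) ^ (r2 n + n) = s"
  assumes exp1: "\<And>n c d. 2 * c = int (r1 n) * (int (r1 n) + 1) \<Longrightarrow> 2 * d = int n * (int n + 1) \<Longrightarrow>
             e (int n) + c = int m1 + (a * int n + 15 * d)"
  assumes exp2: "\<And>n c d. 2 * c = int (r2 n) * (int (r2 n) + 1) \<Longrightarrow> 2 * d = int n * (int n + 1) \<Longrightarrow>
             e (- 1 - int n) + c = int m2 + (b * int n + 15 * d)"
  shows "((\<lambda>k. q powi e k * kernel_sum (\<rho> k)) has_sum
            s * (q ^ m1 * (\<Sum>n. theta_term q a n)) + s * (q ^ m2 * (\<Sum>n. theta_term q b n))) UNIV"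
proof (rule has_sum_int_split)
  have "kernel_sum (\<rho> (int n)) = kernel_sum (int (r1 n))" for n
    using pos[of n] by (elim insertE) (simp_all add: kernel_sum_reflect)
  moreover have "q powi e (int n) * kernel_sum (int (r1 n)) =
      (-1) ^ (r1 n + n) * (q ^ m1 * theta_term q a n)" for n
    by (rule weighted_kernel_sum_eq_theta_term) (rule exp1)
  ultimately have "q powi e (int n) * kernel_sum (\<rho> (int n)) = s * (q ^ m1 * theta_term q a n)" for n
    by (simp only: sgn)
  thus "((\<lambda>n. q powi e (int n) * kernel_sum (\<rho> (int n))) has_sum s * (q ^ m1 * (\<Sum>n. theta_term q a n))) UNIV"
    using has_sum_cmult_right[OF has_sum_cmult_right[OF theta_term_has_sum[OF bound(1)]]] by simp
next
  have "kernel_sum (\<rho> (- 1 - int n)) = kernel_sum (int (r2 n))" for n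
    using neg[of n] by (elim insertE) (simp_all add: kernel_sum_reflect)
  moreover have "q powi e (- 1 - int n) * kernel_sum (int (r2 n)) =
      (-1) ^ (r2 n + n) * (q ^ m2 * theta_term q b n)" for n
    by (rule weighted_kernel_sum_eq_theta_term) (rule exp2)
  ultimately have "q powi e (- 1 - int n) * kernel_sum (\<rho> (- 1 - int n)) = s * (q ^ m2 * theta_term q b n)" for n
    by (simp only: sgn)
  thus "((\<lambda>n. q powi e (- 1 - int n) * kernel_sum (\<rho> (- 1 - int n))) has_sum
           s * (q ^ m2 * (\<Sum>n. theta_term q b n))) UNIV"
    using has_sum_cmult_right[OF has_sum_cmult_right[OF theta_term_has_sum[OF bound(2)]]] by simp
qed

text \<open>It makes 3k^2 - k and 3k^2 + 2k at least |k|, as the interchange requires of the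
  weights.\<close>

lemma abs_le_square_int: "\<bar>k\<bar> \<le> (k\<^sup>2 :: int)"
proof (cases "k = 0")
  case False
  hence "\<bar>k\<bar> * 1 \<le> \<bar>k\<bar> * \<bar>k\<bar>"
    by (intro mult_left_mono) auto
  thus ?thesis by (simp add: power2_eq_square flip: abs_mult)
qed simp

lemma bij_betw_uminus_int: "bij_betw uminus (UNIV :: int set) UNIV"
  by (rule bij_betwI[of _ _ _ uminus]) auto

lemma odd_row_weights_has_sum:
  "((\<lambda>k. q powi (3 * k\<^sup>2 - k) * (kernel_sum (3 * k) - kernel_sum (3 * k - 2))) has_sum
     (\<Sum>n. theta_term q (-7) n) + q ^ 7 * (\<Sum>n. theta_term q 7 n)
     + q * (\<Sum>n. theta_term q (-2) n) + q ^ 3 * (\<Sum>n. theta_term q 2 n)) UNIV"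
proof -
  have 1: "((\<lambda>k. q powi (3 * k\<^sup>2 - k) * kernel_sum (3 * k)) has_sum
      1 * (q ^ 0 * (\<Sum>n. theta_term q (-7) n)) + 1 * (q ^ 7 * (\<Sum>n. theta_term q 7 n))) UNIV"
    by (rule has_sum_weighted_kernel[where ?r1.0 = "\<lambda>n. 3 * n" and ?r2.0 = "\<lambda>n. 3 * n + 2"])
       (auto simp: algebra_simps power2_eq_square minus_one_power_iff)
  \<comment> \<open>The substitution k -> -k comes first: 3k-2 is negative at k = 0 but positive for
    k >= 1, whereas after it both halves have the representative 3n+1 throughout.\<close>
  have "((\<lambda>k. q powi (3 * k\<^sup>2 + k) * kernel_sum (- 3 * k - 2)) has_sum
      (-1) * (q ^ 1 * (\<Sum>n. theta_term q (-2) n)) + (-1) * (q ^ 3 * (\<Sum>n. theta_term q 2 n))) UNIV"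
    by (rule has_sum_weighted_kernel[where ?r1.0 = "\<lambda>n. 3 * n + 1" and ?r2.0 = "\<lambda>n. 3 * n + 1"])
       (auto simp: algebra_simps power2_eq_square minus_one_power_iff)
  hence "((\<lambda>k. q powi (3 * k\<^sup>2 - k) * kernel_sum (3 * k - 2)) has_sum
      (-1) * (q ^ 1 * (\<Sum>n. theta_term q (-2) n)) + (-1) * (q ^ 3 * (\<Sum>n. theta_term q 2 n))) UNIV"
    by (subst has_sum_reindex_bij_betw[OF bij_betw_uminus_int, symmetric]) simp
  from has_sum_add[OF 1 has_sum_uminusI[OF this]] show ?thesis
    by (simp add: algebra_simps)
qed

lemma odd_row_shifted_weights_has_sum:
  "((\<lambda>k. q powi (3 * k\<^sup>2 + 2 * k) * (kernel_sum (3 * k) - kernel_sum (3 * k + 1))) has_sum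
     (\<Sum>n. theta_term q (-4) n) + q ^ 4 * (\<Sum>n. theta_term q 4 n)
     + q * (\<Sum>n. theta_term q (-1) n) + q ^ 2 * (\<Sum>n. theta_term q 1 n)) UNIV"
proof -
  have 1: "((\<lambda>k. q powi (3 * k\<^sup>2 + 2 * k) * kernel_sum (3 * k)) has_sum
      1 * (q ^ 0 * (\<Sum>n. theta_term q (-4) n)) + 1 * (q ^ 4 * (\<Sum>n. theta_term q 4 n))) UNIV"
    by (rule has_sum_weighted_kernel[where ?r1.0 = "\<lambda>n. 3 * n" and ?r2.0 = "\<lambda>n. 3 * n + 2"])
       (auto simp: algebra_simps power2_eq_square minus_one_power_iff)
  have 2: "((\<lambda>k. q powi (3 * k\<^sup>2 + 2 * k) * kernel_sum (3 * k + 1)) has_sum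
      (-1) * (q ^ 1 * (\<Sum>n. theta_term q (-1) n)) + (-1) * (q ^ 2 * (\<Sum>n. theta_term q 1 n))) UNIV"
    by (rule has_sum_weighted_kernel[where ?r1.0 = "\<lambda>n. 3 * n + 1" and ?r2.0 = "\<lambda>n. 3 * n + 1"])
       (auto simp: algebra_simps power2_eq_square minus_one_power_iff)
  from has_sum_add[OF 1 has_sum_uminusI[OF 2]] show ?thesis
    by (simp add: algebra_simps)
qed

lemma odd_row_sums:
  "(\<lambda>n. bailey_weight n * (q ^ (n\<^sup>2) * inv_qfact q (2 * int n + 1))) sums
     ((\<Sum>n. theta_term q (-7) n) + q ^ 7 * (\<Sum>n. theta_term q 7 n)
     + q * (\<Sum>n. theta_term q (-2) n) + q ^ 3 * (\<Sum>n. theta_term q 2 n))"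
proof (rule weighted_kernel_interchange[OF _ _ odd_row_weights_has_sum])
  fix k :: int
  have "\<bar>k\<bar> \<le> k\<^sup>2"
    by (rule abs_le_square_int)
  thus "norm (q powi (3 * k\<^sup>2 - k)) \<le> norm q ^ nat \<bar>k\<bar>"
    by (intro powi_norm_le) (auto simp: abs_if split: if_splits)
next
  fix n :: nat
  show "((\<lambda>k. q powi (3 * k\<^sup>2 - k) * (inv_qfact_pair n (3 * k) - inv_qfact_pair n (3 * k - 2))) has_sum
          q ^ (n\<^sup>2) * inv_qfact q (2 * int n + 1)) UNIV"
    using odd_row_term_has_sum[of n] by (simp add: odd_row_term_def[abs_def] inv_qfact_pair_def algebra_simps)
qed

lemma odd_row_shifted_sums:
  "(\<lambda>n. bailey_weight n * (q ^ (n\<^sup>2 + n) * inv_qfact q (2 * int n + 1))) sums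
     ((\<Sum>n. theta_term q (-4) n) + q ^ 4 * (\<Sum>n. theta_term q 4 n)
     + q * (\<Sum>n. theta_term q (-1) n) + q ^ 2 * (\<Sum>n. theta_term q 1 n))"
proof (rule weighted_kernel_interchange[OF _ _ odd_row_shifted_weights_has_sum])
  fix k :: int
  have "\<bar>k\<bar> \<le> k\<^sup>2"
    by (rule abs_le_square_int)
  thus "norm (q powi (3 * k\<^sup>2 + 2 * k)) \<le> norm q ^ nat \<bar>k\<bar>"
    by (intro powi_norm_le) (auto simp: abs_if split: if_splits)
next
  fix n :: nat
  show "((\<lambda>k. q powi (3 * k\<^sup>2 + 2 * k) * (inv_qfact_pair n (3 * k) - inv_qfact_pair n (3 * k + 1))) has_sum
          q ^ (n\<^sup>2 + n) * inv_qfact q (2 * int n + 1)) UNIV"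
    using odd_row_shifted_term_has_sum[of n] by (simp add: odd_row_shifted_term_def[abs_def] inv_qfact_pair_def algebra_simps)
qed

section \<open>The three series in terms of the Bailey weights\<close>

text \<open>(q;q)_(n+m) factors as (q;q)_n (q^(n+1);q)_m; the factor (q;q)_n is the one contained in
  \<open>bailey_weight n\<close>.\<close>

lemma inverse_qpoch_shift:
  "1 / qpoch (q ^ (n + 1)) q m = qpoch q q n * inv_qfact q (int (n + m))"
  using qpoch_self_nz[of n] qpoch_power_nz[of "n + 1" m]
  unfolding inv_qfact_of_nat qpoch_add[of q q n m] by (simp add: field_simps)

text \<open>The exponent splits as n(n+1)/2 + n(n-1). Truncation of \<open>n - 1\<close> at n = 0 is
  harmless because of the factor \<open>n\<close>.\<close>

lemma lhs_term1_eq: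
  "lhs_term1 q n = bailey_weight n * (q ^ (n * (n - 1)) * inv_qfact q (2 * int n))"
proof -
  have "(3 * (int n)\<^sup>2 - int n) div 2 = int (((n + 1) choose 2) + n * (n - 1))"
    using triangular_double[of n] by (cases n) (simp_all add: power2_eq_square algebra_simps)
  hence "lhs_term1 q n = (-1) ^ n * (q ^ ((n + 1) choose 2) * q ^ (n * (n - 1)))
           * (1 / qpoch (q ^ (n + 1)) q n)"
    unfolding lhs_term1_def by (simp add: power_add del: of_nat_add)
  moreover have "int (n + n) = 2 * int n" by simp
  ultimately show ?thesis
    unfolding inverse_qpoch_shift by (simp only:) (simp add: bailey_weight_def mult_ac)
qed

lemma lhs_term2_eq:
  "lhs_term2 q n = - (bailey_weight n * (q ^ (n\<^sup>2) * inv_qfact q (2 * int n + 1)))"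
proof -
  have "(3 * (int n)\<^sup>2 + int n) div 2 = int (((n + 1) choose 2) + n\<^sup>2)"
    using triangular_double[of n] by (simp add: power2_eq_square algebra_simps)
  hence "lhs_term2 q n = - ((-1) ^ n * (q ^ ((n + 1) choose 2) * q ^ (n\<^sup>2))
           * (1 / qpoch (q ^ (n + 1)) q (n + 1)))"
    unfolding lhs_term2_def by (simp add: power_add del: of_nat_add)
  moreover have "int (n + (n + 1)) = 2 * int n + 1" by simp
  ultimately show ?thesis
    unfolding inverse_qpoch_shift by (simp only:) (simp add: bailey_weight_def mult_ac)
qed

lemma lhs_term3_eq:
  "lhs_term3 q n = - q * (bailey_weight n * (q ^ (n\<^sup>2 + n) * inv_qfact q (2 * int n + 1)))"
proof -
  have "int (3 * ((n + 1) choose 2) + 1) = int (((n + 1) choose 2) + (n\<^sup>2 + n) + 1)"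
    using triangular_double[of n] by (simp add: power2_eq_square algebra_simps)
  hence e: "3 * ((n + 1) choose 2) + 1 = ((n + 1) choose 2) + (n\<^sup>2 + n) + 1"
    by (simp only: of_nat_eq_iff)
  have "lhs_term3 q n = - q * ((-1) ^ n * (q ^ ((n + 1) choose 2) * q ^ (n\<^sup>2 + n))
           * (1 / qpoch (q ^ (n + 1)) q (n + 1)))"
    unfolding lhs_term3_def e by (simp add: power_add)
  moreover have "int (n + (n + 1)) = 2 * int n + 1" by simp
  ultimately show ?thesis
    unfolding inverse_qpoch_shift by (simp only:) (simp add: bailey_weight_def mult_ac)
qed

section \<open>Telescoping difference of the first two series\<close>

text \<open>With x = q^n, both sides share the factor 1 - q^2 x^2 = (1 - qx)(1 + qx); what remains
  is (1 + x)(1 - q x^2) + q x^3 = 1 + x - q x^2.\<close>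

lemma lhs_term1_minus_lhs_term2:
  "lhs_term1 q n - lhs_term2 q n = (1 + q ^ n) * lhs_term1 q n - (1 + q ^ Suc n) * lhs_term1 q (Suc n)"
proof -
  define x Q E where "x = q ^ n" and "Q = q ^ (n * (n - 1))" and "E = inv_qfact q (2 * int n + 2)"
  have "q powi (2 * int n + 2) = q\<^sup>2 * x\<^sup>2" "q powi (2 * int n + 1) = q * x\<^sup>2"
    using q_nz by (simp_all add: x_def power_int_add power_int_mult mult_ac)
  moreover have "2 * int n + 1 + 1 = 2 * int n + 2" by simp
  ultimately have 1: "inv_qfact q (2 * int n + 1) = (1 - q\<^sup>2 * x\<^sup>2) * E"
    and 2: "inv_qfact q (2 * int n) = (1 - q * x\<^sup>2) * ((1 - q\<^sup>2 * x\<^sup>2) * E)"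
    using inv_qfact_rec'[of "2 * int n + 1"] inv_qfact_rec'[of "2 * int n"]
    by (simp_all only: E_def)
  have 3: "q ^ (n\<^sup>2) = Q * x"
    by (cases n) (simp_all add: Q_def x_def power2_eq_square add_ac flip: power_add)
  have 4: "q ^ (Suc n * (Suc n - 1)) = Q * x\<^sup>2"
    using 3 by (simp add: power2_eq_square power_add x_def mult_ac)
  have 5: "2 * int (Suc n) = 2 * int n + 2" by simp
  show ?thesis
    unfolding lhs_term1_eq lhs_term2_eq bailey_weight_Suc 1 2 3 4 5 E_def[symmetric] Q_def[symmetric]
      power_Suc x_def[symmetric]
    by (simp add: algebra_simps power2_eq_square)
qed

lemma lhs_term1_boundary_tendsto_0: "(\<lambda>n. (1 + q ^ n) * lhs_term1 q n) \<longlonglongrightarrow> 0"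
proof (rule Lim_null_comparison)
  \<comment> \<open>\<open>inv_qfact q 0\<close> is 1; it is inserted to give the product the shape
    of a kernel term.\<close>
  have "(\<lambda>n. bailey_weight n * (inv_qfact q (2 * int n) * inv_qfact q 0)) \<longlonglongrightarrow> 0"
    by (rule kernel_tendsto_0)
  hence "(\<lambda>n. bailey_weight n * inv_qfact q (2 * int n)) \<longlonglongrightarrow> 0"
    by (simp add: inv_qfact_def)
  thus "(\<lambda>n. 2 * norm (bailey_weight n * inv_qfact q (2 * int n))) \<longlonglongrightarrow> 0"
    by (intro tendsto_mult_right_zero tendsto_norm_zero)
  have pow: "norm q ^ m \<le> 1" for m
    using q_lt by (intro power_le_one) auto
  have "norm ((1 + q ^ n) * lhs_term1 q n) \<le> 2 * norm (bailey_weight n * inv_qfact q (2 * int n))" for n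
  proof -
    have "norm (1 + q ^ n) \<le> 2"
      using norm_triangle_ineq[of 1 "q ^ n"] pow[of n] by (simp add: norm_power)
    hence "norm (1 + q ^ n) * norm q ^ (n * (n - 1)) * norm (bailey_weight n * inv_qfact q (2 * int n))
            \<le> 2 * 1 * norm (bailey_weight n * inv_qfact q (2 * int n))"
      by (intro mult_mono pow) auto
    thus ?thesis by (simp add: lhs_term1_eq norm_mult norm_power mult_ac)
  qed
  thus "\<forall>\<^sub>F n in sequentially. norm ((1 + q ^ n) * lhs_term1 q n)
           \<le> 2 * norm (bailey_weight n * inv_qfact q (2 * int n))"
    by simp
qed

section \<open>Summation of the three series\<close>

lemma lhs_term2_sums:
  "lhs_term2 q sums - ((\<Sum>n. theta_term q (-7) n) + q ^ 7 * (\<Sum>n. theta_term q 7 n)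
     + q * (\<Sum>n. theta_term q (-2) n) + q ^ 3 * (\<Sum>n. theta_term q 2 n))"
  using sums_minus[OF odd_row_sums] by (simp only: lhs_term2_eq[abs_def])

lemma lhs_term3_sums:
  "lhs_term3 q sums (- q * (\<Sum>n. theta_term q (-4) n) - q ^ 5 * (\<Sum>n. theta_term q 4 n)
     - q ^ 2 * (\<Sum>n. theta_term q (-1) n) - q ^ 3 * (\<Sum>n. theta_term q 1 n))"
proof -
  have "- q * (A + q ^ 4 * B + q * C + q ^ 2 * D) = - q * A - q ^ 5 * B - q ^ 2 * C - q ^ 3 * D"
    for A B C D :: complex
    by (simp add: algebra_simps power_numeral_reduce)
  thus ?thesis
    using sums_mult[OF odd_row_shifted_sums, of "- q"] by (simp only: lhs_term3_eq[abs_def])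
qed

lemma lhs_term1_sums:
  "lhs_term1 q sums (2 - ((\<Sum>n. theta_term q (-7) n) + q ^ 7 * (\<Sum>n. theta_term q 7 n)
     + q * (\<Sum>n. theta_term q (-2) n) + q ^ 3 * (\<Sum>n. theta_term q 2 n)))"
proof -
  \<comment> \<open>The boundary value at n = 0 is the constant 2 of the first identity.\<close>
  have "(\<lambda>n. lhs_term1 q n - lhs_term2 q n) sums ((1 + q ^ 0) * lhs_term1 q 0 - 0)"
    unfolding lhs_term1_minus_lhs_term2 by (rule telescope_sums'[OF lhs_term1_boundary_tendsto_0])
  moreover have "lhs_term1 q 0 = 1" by (simp add: lhs_term1_def)
  ultimately have "(\<lambda>n. lhs_term1 q n - lhs_term2 q n) sums 2" by simp
  from sums_add[OF this lhs_term2_sums] show ?thesis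
    by (simp only: diff_add_cancel add_uminus_conv_diff)
qed

lemma theta_term_summable: "\<bar>a\<bar> \<le> 7 \<Longrightarrow> summable (theta_term q a)"
  by (rule summable_norm_cancel[OF theta_term_summable_norm])

end

theorem theorem3p1:
  fixes q :: complex
  assumes "0 < norm q" and "norm q < 1"
  shows "summable (lhs_term1 q) \<and> summable (lhs_term2 q) \<and> summable (lhs_term3 q) \<and>
    (\<forall>a \<in> {-7, 7, -2, 2, -4, 4, -1, 1}. summable (theta_term q a)) \<and>
    (\<Sum>n. lhs_term1 q n) =
      2 - (\<Sum>n. theta_term q (-7) n) - q ^ 7 * (\<Sum>n. theta_term q 7 n)
        - q * (\<Sum>n. theta_term q (-2) n) - q ^ 3 * (\<Sum>n. theta_term q 2 n) \<and>
    1 + (\<Sum>n. lhs_term2 q n) =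
      1 - (\<Sum>n. theta_term q (-7) n) - q ^ 7 * (\<Sum>n. theta_term q 7 n)
        - q * (\<Sum>n. theta_term q (-2) n) - q ^ 3 * (\<Sum>n. theta_term q 2 n) \<and>
    (\<Sum>n. lhs_term3 q n) =
      - q * (\<Sum>n. theta_term q (-4) n) - q ^ 5 * (\<Sum>n. theta_term q 4 n)
        - q ^ 2 * (\<Sum>n. theta_term q (-1) n) - q ^ 3 * (\<Sum>n. theta_term q 1 n)"
proof -
  interpret q_series q
    by unfold_locales (use assms in auto)
  have "\<forall>a \<in> {-7, 7, -2, 2, -4, 4, -1, 1}. summable (theta_term q a)"
    by (simp add: theta_term_summable)
  thus ?thesis
    using lhs_term1_sums lhs_term2_sums lhs_term3_sums
    by (simp only: sums_iff) (simp add: diff_diff_eq add_ac)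
qed

end
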